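(* Let $C$ be a constraint and let $C_s(\vec{X},Z)$, defined as $m(\vec{X})\le Z$, be a soft constraint where $m$ is an open edit-based violation measure for $L_C$ with weights $\alpha,\beta,\gamma,\delta$ (for substitution, insertion, deletion, transposition respectively). Suppose $\min\{\alpha,\beta,\gamma\}\le\delta$. Then $C_s$ is contractible, i.e. for all sequences $\vec{X}$, variables $Y$ and values of $Z$, $C_s(\vec{X}Y,Z)\rightarrow C_s(\vec{X},Z)$.
   Context: The semantics of a constraint $C$ on sequences of variables is the language $L_C$ of words $d_1\cdots d_n$ such that $X_i=d_i$ is a solution of $C([X_1,\ldots,X_n])$. $P(L)=\{w\mid\exists u\; wu\in L\}$ is the prefix-closure of $L$. The edit operations on words are: substitute one letter for another, insert a letter, delete a letter, transpose two adjacent letters. Given non-negative weights $\alpha,\beta,\gamma,\delta$ (a weight may be effectively infinite), the open edit-based violation measure for a language $L$ is $m(w)=\min(\alpha n_s+\beta n_i+\gamma n_d+\delta n_t)$, minimized over all sequences of edits transforming $w$ into an element of $P(L)$, where $n_s,n_i,n_d,n_t$ count the substitutions, insertions, deletions and transpositions used. *)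

theory Defs
  imports "HOL-Library.Extended_Nonnegative_Real"
begin

text \<open>A constraint on sequences of variables is represented by its truth value under a
  valuation: for \<open>C :: 'd list \<Rightarrow> bool\<close>, the proposition \<open>C [d\<^sub>1, \<dots>, d\<^sub>n]\<close> says that
  \<open>X\<^sub>i = d\<^sub>i\<close> is a solution of \<open>C([X\<^sub>1, \<dots>, X\<^sub>n])\<close>. An implication between constraints
  over shared variables is therefore an implication that holds for all values.\<close>

definition language :: "('d list \<Rightarrow> bool) \<Rightarrow> 'd list set" where
  "language C = {w. C w}"

definition prefix_closure :: "'d list set \<Rightarrow> 'd list set" where
  "prefix_closure L = {w. \<exists>u. w @ u \<in> L}"

datatype edit = Substitution | Insertion | Deletion | Transposition

inductive edit_step :: "edit \<Rightarrow> 'd list \<Rightarrow> 'd list \<Rightarrow> bool" where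
  substitution: "a \<noteq> b \<Longrightarrow> edit_step Substitution (u @ [a] @ v) (u @ [b] @ v)"
| insertion: "edit_step Insertion (u @ v) (u @ [a] @ v)"
| deletion: "edit_step Deletion (u @ [a] @ v) (u @ v)"
| transposition: "edit_step Transposition (u @ [a, b] @ v) (u @ [b, a] @ v)"

inductive edit_sequence :: "edit list \<Rightarrow> 'd list \<Rightarrow> 'd list \<Rightarrow> bool" where
  Nil: "edit_sequence [] w w"
| Cons: "edit_step e w w' \<Longrightarrow> edit_sequence es w' w'' \<Longrightarrow> edit_sequence (e # es) w w''"

text \<open>Weights are extended non-negative reals; an infinite weight forbids an edit operation.
  Since \<open>\<infinity> * 0 = 0\<close>, it does not affect edit sequences in which the operation is not used.\<close>

definition edit_cost :: "ennreal \<Rightarrow> ennreal \<Rightarrow> ennreal \<Rightarrow> ennreal \<Rightarrow> edit list \<Rightarrow> ennreal" where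
  "edit_cost \<alpha> \<beta> \<gamma> \<delta> es =
     \<alpha> * of_nat (count_list es Substitution) + \<beta> * of_nat (count_list es Insertion)
     + \<gamma> * of_nat (count_list es Deletion) + \<delta> * of_nat (count_list es Transposition)"

text \<open>The infimum is a minimum whenever \<open>L\<close> is nonempty: for fixed weights, only finitely many
  values of \<open>edit_cost\<close> lie below any finite bound. For empty \<open>L\<close> it is \<open>\<infinity>\<close>.\<close>

definition open_edit_measure ::
    "ennreal \<Rightarrow> ennreal \<Rightarrow> ennreal \<Rightarrow> ennreal \<Rightarrow> 'd list set \<Rightarrow> 'd list \<Rightarrow> ennreal" where
  "open_edit_measure \<alpha> \<beta> \<gamma> \<delta> L w =
     Inf {edit_cost \<alpha> \<beta> \<gamma> \<delta> es | es. \<exists>u \<in> prefix_closure L. edit_sequence es w u}"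

definition soft_constraint :: "('d list \<Rightarrow> ennreal) \<Rightarrow> 'd list \<Rightarrow> ennreal \<Rightarrow> bool" where
  "soft_constraint m xs z \<longleftrightarrow> m xs \<le> z"

definition contractible :: "('d list \<Rightarrow> 'z \<Rightarrow> bool) \<Rightarrow> bool" where
  "contractible C \<longleftrightarrow> (\<forall>xs y z. C (xs @ [y]) z \<longrightarrow> C xs z)"

end

theory Submission imports Defs begin

text \<open>Run the edits of \<open>w y\<close> on the prefix \<open>w\<close>, skipping those that fall outside the current
  prefix \<open>p\<close>; the result is a prefix of a word in \<open>P(L)\<close>. The only edit that straddles the end
  of the prefix is a transposition of \<open>a\<close> and \<open>b\<close> in \<open>p = u a\<close>, with \<open>b\<close> the next letter. The
  new word starts with \<open>u b a\<close>, and each of its prefixes \<open>u b\<close>, \<open>u\<close> and \<open>u b a\<close> is obtained from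
  \<open>u a\<close> by at most one edit: a substitution, a deletion and an insertion, respectively. So the
  cheapest of the three operations can replace the transposition.\<close>

text \<open>Locates the end of \<open>p\<close> relative to an edit at the start of
  \<open>r\<close>. The boundary case \<open>p = u\<close> falls under the first alternative, so an
  insertion exactly at the end of \<open>p\<close> counts as outside.\<close>

lemma append_eq_append_cases:
  assumes "p @ t = u @ r"
  obtains s where "u = p @ s" | x q where "p = u @ x # q" "r = x # q @ t"
proof -
  obtain q where "p = u @ q \<and> q @ t = r \<or> p @ q = u \<and> t = q @ r"
    using assms by (auto simp: append_eq_append_conv2)
  then show thesis
    using that by (cases q) auto
qed

lemma boundary_transposition:
  assumes "e \<noteq> Transposition"
  shows "\<exists>p' t'. u @ b # a # v = p' @ t' \<and> (p' = u @ [a] \<or> edit_step e (u @ [a]) p')"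
proof (cases e)
  case Substitution
  \<comment> \<open>A substitution has to change the letter. For \<open>a = b\<close> the new word
    still starts with \<open>u @ [a]\<close>, so the prefix is left alone.\<close>
  show ?thesis
  proof (cases "a = b")
    case True
    then show ?thesis by (intro exI[of _ "u @ [a]"] exI[of _ "a # v"]) simp
  next
    case False
    from edit_step.substitution[OF this, of u "[]"] show ?thesis
      using Substitution by (intro exI[of _ "u @ [b]"] exI[of _ "a # v"]) simp
  qed
next
  case Insertion
  from edit_step.insertion[of u "[a]" b] show ?thesis
    using Insertion by (intro exI[of _ "u @ [b, a]"] exI[of _ v]) simp
next
  case Deletion
  from edit_step.deletion[of u a "[]"] show ?thesis
    using Deletion by (intro exI[of _ u] exI[of _ "b # a # v"]) simp
qed (use assms in simp)

text \<open>An edit starting past \<open>p\<close> is skipped; one lying inside \<open>p\<close> is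
  performed there and leaves \<open>t\<close> as it is. The replacement \<open>e\<^sub>0\<close> is
  fixed in advance, so it can later be chosen by weight alone.\<close>

lemma edit_step_prefix:
  assumes step: "edit_step e (p @ t) w'" and e\<^sub>0: "e\<^sub>0 \<noteq> Transposition"
  shows "\<exists>p' t'. w' = p' @ t' \<and>
    (p' = p \<or> edit_step e p p' \<or> e = Transposition \<and> edit_step e\<^sub>0 p p')"
  using step
proof cases
  case (substitution a b u v)
  from substitution(2) show ?thesis
  proof (cases rule: append_eq_append_cases)
    case (1 s)
    with substitution show ?thesis
      by (intro exI[of _ p] exI[of _ "s @ [b] @ v"]) simp
  next
    case (2 x q)
    with substitution edit_step.substitution[of a b u q] show ?thesis
      by (intro exI[of _ "u @ b # q"] exI[of _ t]) simp
  qed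
next
  case (insertion u v a)
  from insertion(2) show ?thesis
  proof (cases rule: append_eq_append_cases)
    case (1 s)
    with insertion show ?thesis
      by (intro exI[of _ p] exI[of _ "s @ [a] @ v"]) simp
  next
    case (2 x q)
    with insertion edit_step.insertion[of u "x # q" a] show ?thesis
      by (intro exI[of _ "u @ a # x # q"] exI[of _ t]) simp
  qed
next
  case (deletion u a v)
  from deletion(2) show ?thesis
  proof (cases rule: append_eq_append_cases)
    case (1 s)
    with deletion show ?thesis
      by (intro exI[of _ p] exI[of _ "s @ v"]) simp
  next
    case (2 x q)
    with deletion edit_step.deletion[of u a q] show ?thesis
      by (intro exI[of _ "u @ q"] exI[of _ t]) simp
  qed
next
  case (transposition u a b v)
  from transposition(2) show ?thesis
  proof (cases rule: append_eq_append_cases)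
    case (1 s)
    with transposition show ?thesis
      by (intro exI[of _ p] exI[of _ "s @ [b, a] @ v"]) simp
  next
    case (2 x q)
    show ?thesis
    \<comment> \<open>Here \<open>x = a\<close>, and \<open>q\<close> is the part of
      \<open>p\<close> after it. If \<open>q\<close> is empty, \<open>p\<close> ends between the two
      transposed letters; otherwise both lie in \<open>p\<close>.\<close>
    proof (cases q)
      case Nil
      then show ?thesis
        using 2 transposition boundary_transposition[OF e\<^sub>0, of u b a v] by auto
    next
      case (Cons y q')
      with 2 transposition edit_step.transposition[of u a b q'] show ?thesis
        by (intro exI[of _ "u @ b # a # q'"] exI[of _ t]) simp
    qed
  qed
qed

lemma edit_cost_Cons:
  "edit_cost \<alpha> \<beta> \<gamma> \<delta> (e # es) = edit_cost \<alpha> \<beta> \<gamma> \<delta> [e] + edit_cost \<alpha> \<beta> \<gamma> \<delta> es"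
  by (cases e) (simp_all add: edit_cost_def algebra_simps)

text \<open>Costs are compared edit by edit: a skipped edit saves its non-negative weight, a kept
  one costs the same, and a transposition replaced by \<open>e\<^sub>0\<close> had weight \<delta>.
  Since edits can move the cut between prefix and rest, the induction generalises over
  \<open>p\<close> and \<open>t\<close>.\<close>

lemma edit_sequence_prefix:
  assumes "edit_sequence es (p @ t) w'"
    and "e\<^sub>0 \<noteq> Transposition" and cost: "edit_cost \<alpha> \<beta> \<gamma> \<delta> [e\<^sub>0] \<le> \<delta>"
  shows "\<exists>es' p' t'. w' = p' @ t' \<and> edit_sequence es' p p' \<and>
    edit_cost \<alpha> \<beta> \<gamma> \<delta> es' \<le> edit_cost \<alpha> \<beta> \<gamma> \<delta> es"
  using assms(1)
proof (induction es "p @ t" w' arbitrary: p t rule: edit_sequence.induct)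
  case Nil
  show ?case using edit_sequence.Nil[of p] by blast
next
  case (Cons e w' es w'')
  obtain p' t' where w': "w' = p' @ t'"
    and *: "p' = p \<or> edit_step e p p' \<or> e = Transposition \<and> edit_step e\<^sub>0 p p'"
    using edit_step_prefix[OF Cons.hyps(1) assms(2)] by blast
  obtain es' p'' t'' where w'': "w'' = p'' @ t''" and es': "edit_sequence es' p' p''"
    and le: "edit_cost \<alpha> \<beta> \<gamma> \<delta> es' \<le> edit_cost \<alpha> \<beta> \<gamma> \<delta> es"
    using Cons.hyps(3)[OF w'] by blast
  have transposition_cost: "edit_cost \<alpha> \<beta> \<gamma> \<delta> [Transposition] = \<delta>"
    by (simp add: edit_cost_def)
  from * have "\<exists>fs. edit_sequence fs p p'' \<and> edit_cost \<alpha> \<beta> \<gamma> \<delta> fs \<le> edit_cost \<alpha> \<beta> \<gamma> \<delta> (e # es)"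
  proof (elim disjE conjE)
    assume "p' = p"
    moreover have "edit_cost \<alpha> \<beta> \<gamma> \<delta> es' \<le> edit_cost \<alpha> \<beta> \<gamma> \<delta> (e # es)"
      unfolding edit_cost_Cons[of _ _ _ _ e es] using le by (simp add: add_increasing)
    ultimately show ?thesis using es' by blast
  next
    assume "edit_step e p p'"
    then have "edit_sequence (e # es') p p''" using es' by (rule edit_sequence.Cons)
    moreover have "edit_cost \<alpha> \<beta> \<gamma> \<delta> (e # es') \<le> edit_cost \<alpha> \<beta> \<gamma> \<delta> (e # es)"
      unfolding edit_cost_Cons[of _ _ _ _ e es'] edit_cost_Cons[of _ _ _ _ e es]
      using le by (rule add_left_mono)
    ultimately show ?thesis by blast
  next
    assume e: "e = Transposition" and "edit_step e\<^sub>0 p p'"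
    then have "edit_sequence (e\<^sub>0 # es') p p''" using es' e
      by (auto intro: edit_sequence.Cons)
    moreover have "edit_cost \<alpha> \<beta> \<gamma> \<delta> (e\<^sub>0 # es') \<le> edit_cost \<alpha> \<beta> \<gamma> \<delta> (e # es)"
      unfolding edit_cost_Cons[of _ _ _ _ e\<^sub>0 es'] edit_cost_Cons[of _ _ _ _ Transposition es]
        e transposition_cost
      using cost le by (rule add_mono)
    ultimately show ?thesis by blast
  qed
  then show ?case using w'' by blast
qed

lemma prefix_closure_appendD: "u @ v \<in> prefix_closure L \<Longrightarrow> u \<in> prefix_closure L"
  by (auto simp: prefix_closure_def)

lemma open_edit_measure_append:
  assumes "Min {\<alpha>, \<beta>, \<gamma>} \<le> \<delta>"
  shows "open_edit_measure \<alpha> \<beta> \<gamma> \<delta> L p \<le> open_edit_measure \<alpha> \<beta> \<gamma> \<delta> L (p @ t)"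
proof -
  have "\<alpha> \<le> \<delta> \<or> \<beta> \<le> \<delta> \<or> \<gamma> \<le> \<delta>"
    using assms by (auto simp: min_le_iff_disj)
  \<comment> \<open>A one-element edit list costs exactly the weight of its operation, so any
    operation of weight at most \<delta> can serve as the replacement.\<close>
  then have "\<exists>e. e \<noteq> Transposition \<and> edit_cost \<alpha> \<beta> \<gamma> \<delta> [e] \<le> \<delta>"
  proof (elim disjE)
    assume "\<alpha> \<le> \<delta>"
    then show ?thesis by (intro exI[of _ Substitution]) (simp add: edit_cost_def)
  next
    assume "\<beta> \<le> \<delta>"
    then show ?thesis by (intro exI[of _ Insertion]) (simp add: edit_cost_def)
  next
    assume "\<gamma> \<le> \<delta>"
    then show ?thesis by (intro exI[of _ Deletion]) (simp add: edit_cost_def)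
  qed
  then obtain e where e: "e \<noteq> Transposition" "edit_cost \<alpha> \<beta> \<gamma> \<delta> [e] \<le> \<delta>" by blast
  show ?thesis
    unfolding open_edit_measure_def
  \<comment> \<open>Each cost available for \<open>p @ t\<close> is bounded below by one available
    for \<open>p\<close>; this also covers an empty set of costs, whose infimum is infinite.\<close>
  proof (rule Inf_mono, clarify)
    fix es w
    assume w: "w \<in> prefix_closure L" and "edit_sequence es (p @ t) w"
    with edit_sequence_prefix[OF _ e] obtain es' p' t' where
      "w = p' @ t'" "edit_sequence es' p p'" "edit_cost \<alpha> \<beta> \<gamma> \<delta> es' \<le> edit_cost \<alpha> \<beta> \<gamma> \<delta> es"
      by blast
    \<comment> \<open>Openness of the measure enters here: the target set is closed under prefixes,
      so the shortened result is still a legal target.\<close>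
    moreover from calculation w have "p' \<in> prefix_closure L" by (auto dest: prefix_closure_appendD)
    ultimately show "\<exists>c\<in>{edit_cost \<alpha> \<beta> \<gamma> \<delta> es |es. \<exists>u\<in>prefix_closure L. edit_sequence es p u}.
        c \<le> edit_cost \<alpha> \<beta> \<gamma> \<delta> es"
      by blast
  qed
qed

theorem theorem3:
  fixes C :: "'d list \<Rightarrow> bool"
    and \<alpha> \<beta> \<gamma> \<delta> :: ennreal
    and m :: "'d list \<Rightarrow> ennreal"
  assumes "m = open_edit_measure \<alpha> \<beta> \<gamma> \<delta> (language C)"
    and "Min {\<alpha>, \<beta>, \<gamma>} \<le> \<delta>"
  shows "contractible (soft_constraint m)"
  unfolding contractible_def soft_constraint_def assms(1)
  \<comment> \<open>With \<open>t = [y]\<close>, the measure of \<open>xs\<close> is at most that of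
    \<open>xs @ [y]\<close>, hence at most \<open>z\<close>.\<close>
  using open_edit_measure_append[OF assms(2)] order_trans by blast

end
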